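(* Let $G$ be a simple algebraic group of rank $n\ge 2$, with simple roots $S=\{\alpha_1,\dots,\alpha_n\}$. The Coxeter elements $c\in W$ satisfying $c^{-1}\big(\sum_{t=1}^{n}\alpha_t\big)\in -S$ are described as follows: (1) If $G$ is simply-laced, then for every simple root $\alpha_i$ there is a unique Coxeter element $c_i$ such that $c_i^{-1}\big(\sum_{t=1}^{n}\alpha_t\big)=-\alpha_i$. (2) If $G$ is not simply-laced, then for every short simple root $\alpha_i$ there is a unique Coxeter element $c_i$ such that $c_i^{-1}\big(\sum_{t=1}^{n}\alpha_t\big)=-\alpha_i$, and for a long simple root $\alpha_i$ there is no Coxeter element $c$ with $c^{-1}\big(\sum_{t=1}^{n}\alpha_t\big)=-\alpha_i$.
   Context: $G$ is simply connected over $\mathbb{C}$, $T$ a maximal torus, $W=N_G(T)/T$ the Weyl group, $S=\{\alpha_1,\dots,\alpha_n\}$ the simple roots with respect to a Borel subgroup containing $T$, $s_i$ the simple reflection of $\alpha_i$. A Coxeter element is an element of $W$ of the form $s_{\sigma(1)}\cdots s_{\sigma(n)}$ for some permutation $\sigma$ of $\{1,\dots,n\}$. *)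

theory Defs
  imports "HOL-Analysis.Analysis" "HOL-Combinatorics.Permutations"
begin

text \<open>
  A simple algebraic group over the complex numbers with a maximal torus \<open>T\<close> is represented by its
  root system \<open>\<Phi>\<close>, placed in the Euclidean space spanned by the roots (the characters of \<open>T\<close>
  tensored with the reals, with an inner product invariant under the Weyl group).  This is an
  irreducible reduced crystallographic root system; Borel subgroups containing \<open>T\<close> correspond to
  bases of \<open>\<Phi>\<close>, and \<open>N(T)/T\<close> acts faithfully on the space as the group generated by the root
  reflections.
\<close>

definition reflection :: "'a::real_inner \<Rightarrow> 'a \<Rightarrow> 'a" where
  "reflection a v = v - (2 * (v \<bullet> a) / (a \<bullet> a)) *\<^sub>R a"

definition root_system :: "'a::euclidean_space set \<Rightarrow> bool" where
  "root_system \<Phi> \<longleftrightarrow>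
     finite \<Phi> \<and> 0 \<notin> \<Phi> \<and> span \<Phi> = UNIV \<and>
     (\<forall>a\<in>\<Phi>. \<forall>b\<in>\<Phi>. reflection a b \<in> \<Phi>) \<and>
     (\<forall>a\<in>\<Phi>. \<forall>b\<in>\<Phi>. 2 * (b \<bullet> a) / (a \<bullet> a) \<in> \<int>) \<and>
     (\<forall>a\<in>\<Phi>. \<forall>r::real. r *\<^sub>R a \<in> \<Phi> \<longrightarrow> r = 1 \<or> r = -1)"

definition irreducible_root_system :: "'a::euclidean_space set \<Rightarrow> bool" where
  "irreducible_root_system \<Phi> \<longleftrightarrow>
     root_system \<Phi> \<and> \<Phi> \<noteq> {} \<and>
     \<not> (\<exists>A B. A \<noteq> {} \<and> B \<noteq> {} \<and> A \<union> B = \<Phi> \<and> A \<inter> B = {} \<and>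
             (\<forall>a\<in>A. \<forall>b\<in>B. a \<bullet> b = 0))"

definition root_base :: "'a::euclidean_space set \<Rightarrow> 'a set \<Rightarrow> bool" where
  "root_base \<Phi> S \<longleftrightarrow>
     S \<subseteq> \<Phi> \<and> independent S \<and> span S = UNIV \<and>
     (\<forall>b\<in>\<Phi>. \<exists>k::'a \<Rightarrow> int. b = (\<Sum>a\<in>S. of_int (k a) *\<^sub>R a) \<and>
             ((\<forall>a\<in>S. 0 \<le> k a) \<or> (\<forall>a\<in>S. k a \<le> 0)))"

text \<open>Closure under inverses is automatic because reflections are involutions.\<close>

inductive_set weyl_group :: "'a::euclidean_space set \<Rightarrow> ('a \<Rightarrow> 'a) set"
  for \<Phi> :: "'a set" where
  weyl_id: "id \<in> weyl_group \<Phi>"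
| weyl_reflection: "a \<in> \<Phi> \<Longrightarrow> w \<in> weyl_group \<Phi> \<Longrightarrow> reflection a \<circ> w \<in> weyl_group \<Phi>"

text \<open>The simple roots are enumerated as \<open>\<alpha> 1, \<dots>, \<alpha> n\<close>.\<close>

definition coxeter_elements ::
    "'a::euclidean_space set \<Rightarrow> nat \<Rightarrow> (nat \<Rightarrow> 'a) \<Rightarrow> ('a \<Rightarrow> 'a) set" where
  "coxeter_elements \<Phi> n \<alpha> =
     {c \<in> weyl_group \<Phi>. \<exists>\<sigma>. \<sigma> permutes {1..n} \<and>
        c = foldr (\<circ>) (map (\<lambda>k. reflection (\<alpha> (\<sigma> k))) [1..<Suc n]) id}"

text \<open>
  All bonds of the Dynkin diagram are simple: the number of edges joining the distinct simple
  roots \<open>a\<close> and \<open>b\<close> is the product of the two Cartan integers.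
\<close>

definition simply_laced :: "'a::euclidean_space set \<Rightarrow> bool" where
  "simply_laced S \<longleftrightarrow>
     (\<forall>a\<in>S. \<forall>b\<in>S. a \<noteq> b \<longrightarrow>
        (2 * (a \<bullet> b) / (b \<bullet> b)) * (2 * (b \<bullet> a) / (a \<bullet> a)) \<le> 1)"

text \<open>
  An irreducible root system has at most two root lengths; if it has two, its roots are thereby
  divided into short and long ones.  The two notions below are only used in that case.
\<close>

definition short_root :: "'a::euclidean_space set \<Rightarrow> 'a \<Rightarrow> bool" where
  "short_root \<Phi> a \<longleftrightarrow> a \<in> \<Phi> \<and> (\<forall>b\<in>\<Phi>. norm a \<le> norm b)"

definition long_root :: "'a::euclidean_space set \<Rightarrow> 'a \<Rightarrow> bool" where
  "long_root \<Phi> a \<longleftrightarrow> a \<in> \<Phi> \<and> (\<forall>b\<in>\<Phi>. norm b \<le> norm a)"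

end

theory Submission
  imports Defs
begin

text \<open>
  A Coxeter element is the product of a word \<open>w\<close> listing every simple root once, and the condition
  on \<open>c\<close> says that \<open>c\<close> sends the simple root \<open>a\<close> to \<open>- \<Sum>S\<close>.  Let the letters of \<open>w\<close> act on
  \<open>a\<close> one by one, starting from the right.  The letter \<open>k\<close> changes only the coefficient of \<open>k\<close>, so
  each coefficient is final as soon as its letter has acted, and it must then be \<open>-1\<close>.  Comparing
  coefficients shows that \<open>a\<close> is the letter that acts first, and that whenever a further letter \<open>k\<close>
  acts after the letters of a suffix \<open>v\<close>, the Cartan number of \<open>sum_list v\<close> against \<open>k\<close> is \<open>-1\<close>.
  Such words are called growing: they enumerate the Dynkin diagram outwards from \<open>a\<close>, each new
  vertex being attached to exactly one of the old ones.

  Two growing words for \<open>a\<close> with the same letters have the same product: the letter that acts last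
  in one of them is a leaf of the diagram, so in the other one it commutes past everything that
  acts after it, and removing it from both words leaves shorter growing words
  (\<open>growing_word_product_unique\<close>).

  Existence is governed by lengths.  The sum \<open>v\<close> of the letters of a growing word is, up to sign, an
  image of \<open>a\<close> under the Weyl group, hence a root of the same length as \<open>a\<close>.  If \<open>a\<close> is shortest
  among the simple roots and letters are missing, connectedness of the diagram gives a missing \<open>k\<close>
  with negative Cartan number against \<open>v\<close>; as \<open>v\<close> is not longer than \<open>k\<close>, that number is \<open>-1\<close>
  and the word grows (\<open>growing_word_exists\<close>).  Conversely, a Cartan number \<open>-1\<close> forces \<open>k\<close> to be at
  least as long as \<open>v\<close> (\<open>growing_word_norm_le\<close>).  So a Coxeter element exists for \<open>a\<close>, and is then
  unique, exactly if \<open>a\<close> is a shortest simple root.  In the simply-laced case all simple roots have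
  the same length; otherwise a long simple root is not among the shortest.
\<close>

section \<open>Reflections and products of reflections\<close>

abbreviation cartan :: "'a::real_inner \<Rightarrow> 'a \<Rightarrow> real" where
  "cartan v a \<equiv> 2 * (v \<bullet> a) / (a \<bullet> a)"

definition reflection_product :: "'a::real_inner list \<Rightarrow> 'a \<Rightarrow> 'a" where
  "reflection_product w = foldr (\<circ>) (map reflection w) id"

lemma reflection_product_Nil [simp]: "reflection_product [] = id"
  by (simp add: reflection_product_def)

lemma reflection_product_Cons [simp]:
  "reflection_product (a # w) = reflection a \<circ> reflection_product w"
  by (simp add: reflection_product_def)

lemma linear_reflection: "linear (reflection a)"
  by (rule linearI)
     (auto simp: reflection_def inner_add_left algebra_simps add_divide_distrib)

lemma reflection_self: "a \<noteq> 0 \<Longrightarrow> reflection a a = - a"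
  by (simp add: reflection_def algebra_simps scaleR_2)

lemma reflection_involution: "a \<noteq> 0 \<Longrightarrow> reflection a (reflection a v) = v"
  by (simp add: reflection_def inner_diff_left field_simps)

lemma norm_reflection: "norm (reflection a v) = norm v"
proof (cases "a = 0")
  case False
  then have "reflection a v \<bullet> reflection a v = v \<bullet> v"
    by (simp add: reflection_def inner_diff_left inner_diff_right inner_commute field_simps)
  then show ?thesis by (simp add: norm_eq)
qed (simp add: reflection_def)

lemma norm_reflection_product: "norm (reflection_product w v) = norm v"
  by (induction w) (auto simp: norm_reflection)

lemma linear_reflection_product: "linear (reflection_product w)"
  by (induction w) (auto simp: linear_reflection linear_compose linear_id[unfolded id_def] id_def
      simp del: o_apply)

lemma bij_reflection_product:
  assumes "0 \<notin> set w"
  shows "bij (reflection_product w)"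
  using assms
proof (induction w)
  case (Cons a w)
  then have "bij (reflection a)"
    by (intro o_bij[of "reflection a"]) (auto simp: fun_eq_iff reflection_involution)
  moreover have "bij (reflection_product w)" using Cons by simp
  ultimately show ?case unfolding reflection_product_Cons by (rule bij_comp[rotated])
qed simp

lemma reflection_commute:
  assumes "a \<bullet> b = 0"
  shows "reflection a \<circ> reflection b = reflection b \<circ> reflection a"
  using assms by (auto simp: fun_eq_iff reflection_def inner_diff_left inner_commute[of b a])

lemma reflection_product_move_to_front:
  assumes "\<forall>x\<in>set u. x \<bullet> k = 0"
  shows "reflection_product (u @ k # v) = reflection_product (k # u @ v)"
  using assms
proof (induction u)
  case (Cons x u)
  have "reflection_product (u @ k # v) = reflection_product (k # u @ v)"
    using Cons by (meson list.set_intros(2))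
  then have "reflection_product ((x # u) @ k # v)
      = reflection x \<circ> (reflection k \<circ> reflection_product (u @ v))"
    unfolding append_Cons reflection_product_Cons by (rule arg_cong)
  also have "\<dots>
      = (reflection x \<circ> reflection k) \<circ> reflection_product (u @ v)"
    by (simp only: o_assoc)
  also have "reflection x \<circ> reflection k = reflection k \<circ> reflection x"
    using Cons.prems by (intro reflection_commute) simp
  finally show ?case by (simp add: o_assoc)
qed simp

lemma reflection_product_in_span:
  assumes "v \<in> span B" "set w \<subseteq> B"
  shows "reflection_product w v \<in> span B"
  using assms(2)
proof (induction w)
  case (Cons a w)
  then show ?case
    by (auto simp: reflection_def intro: span_diff span_scale span_base)
qed (use assms(1) in simp)

lemma reflection_product_in_weyl_group:
  "set w \<subseteq> \<Phi> \<Longrightarrow> reflection_product w \<in> weyl_group \<Phi>"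
  by (induction w) (auto intro: weyl_group.intros)

lemma reflection_product_eq_iff_preimage:
  assumes "0 \<notin> set w"
  shows "inv (reflection_product w) b = - a \<longleftrightarrow> reflection_product w a = - b"
proof -
  have "inv (reflection_product w) b = - a \<longleftrightarrow> b = reflection_product w (- a)"
    using bij_inv_eq_iff[OF bij_reflection_product[OF assms]] by metis
  also have "\<dots> \<longleftrightarrow> reflection_product w a = - b"
    using linear_neg[OF linear_reflection_product, of w a] by auto
  finally show ?thesis .
qed

section \<open>Words growing outwards from a simple root\<close>

text \<open>
  Words grow at the front because the rightmost letter of a product acts first.  The Cartan number
  \<open>-1\<close> is what makes the reflection in \<open>k\<close> add exactly one copy of \<open>k\<close> to the sum.
\<close>

inductive growing_word :: "'a::real_inner set \<Rightarrow> 'a \<Rightarrow> 'a list \<Rightarrow> bool" for S a where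
  start: "a \<in> S \<Longrightarrow> growing_word S a [a]"
| grow: "growing_word S a w \<Longrightarrow> k \<in> S \<Longrightarrow> k \<notin> set w \<Longrightarrow> cartan (sum_list w) k = -1
    \<Longrightarrow> growing_word S a (k # w)"

inductive_cases growing_word_ConsE: "growing_word S a (k # w)"

lemma growing_word_facts:
  assumes "growing_word S a w"
  shows "w \<noteq> [] \<and> distinct w \<and> a \<in> set w \<and> set w \<subseteq> S"
  using assms by induction auto

lemma growing_word_tl:
  assumes "growing_word S a (k # w)" "w \<noteq> []"
  shows "growing_word S a w" "cartan (sum_list w) k = -1"
  using assms by (auto elim: growing_word_ConsE)

lemma growing_word_suffix:
  "growing_word S a (u @ w) \<Longrightarrow> w \<noteq> [] \<Longrightarrow> growing_word S a w"
  by (induction u) (auto dest: growing_word_tl)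

lemma reflection_product_growing_word:
  assumes "growing_word S a w" "0 \<notin> S"
  shows "reflection_product w a = - sum_list w"
  using assms
proof induction
  case start
  then have "a \<noteq> 0" by auto
  then show ?case by (simp add: reflection_self)
next
  case (grow w k)
  then show ?case
    by (simp add: linear_neg[OF linear_reflection] reflection_def)
qed

text \<open>
  Letters in front of \<open>k\<close> that are orthogonal to \<open>k\<close> have the same Cartan number against the sum
  of the letters behind them whether or not \<open>k\<close> is present.
\<close>

lemma growing_word_remove_leaf:
  assumes "growing_word S a (u @ k # v)" "v \<noteq> []" "\<forall>x\<in>set u. x \<bullet> k = 0"
  shows "growing_word S a (u @ v)"
  using assms
proof (induction u)
  case Nil
  then show ?case by (auto dest: growing_word_tl)
next
  case (Cons x u)
  have *: "growing_word S a (u @ k # v)" "cartan (sum_list (u @ k # v)) x = -1"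
    using growing_word_tl[of S a x "u @ k # v"] Cons.prems(1) by auto
  have "cartan (sum_list (u @ v)) x = -1"
    using * Cons.prems(3) by (simp add: inner_add_left inner_commute[of k x])
  moreover have "x \<in> S" "x \<notin> set (u @ v)"
    using growing_word_facts[OF Cons.prems(1)] by auto
  ultimately show ?case
    using Cons * by (auto intro: growing_word.grow)
qed

text \<open>
  By induction on the first word \<open>k # w\<close>.  If the second word is \<open>u @ k # v\<close>, the sums over
  \<open>w\<close> and over \<open>v\<close> both have Cartan number \<open>-1\<close> against \<open>k\<close>, so the letters of \<open>u\<close> contribute \<open>0\<close>
  in total; their contributions are all nonpositive and hence all \<open>0\<close>.  Thus \<open>k\<close> can be moved
  to the front of the second word and cancelled.
\<close>

lemma growing_word_product_unique:
  assumes obtuse: "\<And>x y. x \<in> S \<Longrightarrow> y \<in> S \<Longrightarrow> x \<noteq> y \<Longrightarrow> x \<bullet> y \<le> 0"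
    and "growing_word S a w" "growing_word S a w'" "set w = set w'"
  shows "reflection_product w = reflection_product w'"
  using assms(2-)
proof (induction arbitrary: w')
  case start
  then show ?case
    using growing_word_facts[OF start(2)] by (cases w'; cases "tl w'") auto
next
  case (grow w k w')
  note w = growing_word_facts[OF grow.hyps(1)]
  note w' = growing_word_facts[OF grow.prems(1)]
  have "k \<in> set w'" using grow.prems(2) by auto
  then obtain u v where uv: "w' = u @ k # v" by (meson split_list)
  have kv: "growing_word S a (k # v)"
    using growing_word_suffix grow.prems(1) uv by blast
  have "k \<noteq> a" using w grow.hyps by auto
  then have v: "v \<noteq> []" using kv growing_word_facts[OF kv] by auto
  have set_uv: "set (u @ v) = set w"
    using grow.prems(2) grow.hyps w' uv by auto
  have dist: "distinct (u @ v)" using w' uv by auto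
  have "sum_list w = sum_list u + sum_list v"
    using w dist set_uv distinct_sum_list_conv_Sum by (metis sum_list.append)
  moreover have "cartan (sum_list v) k = -1" using growing_word_tl[OF kv v] by blast
  moreover have "k \<noteq> 0" using grow.hyps by auto
  ultimately have "sum_list u \<bullet> k = 0"
    using grow.hyps by (simp add: inner_add_left field_simps)
  moreover have "sum_list u = \<Sum>(set u)"
    using dist distinct_sum_list_conv_Sum by auto
  ultimately have "(\<Sum>x\<in>set u. - (x \<bullet> k)) = 0"
    by (simp add: inner_sum_left sum_negf)
  moreover have "\<forall>x\<in>set u. 0 \<le> - (x \<bullet> k)"
    using w' uv obtuse[of _ k] by auto
  ultimately have orth: "\<forall>x\<in>set u. x \<bullet> k = 0"
    using sum_nonneg_eq_0_iff[of "set u" "\<lambda>x. - (x \<bullet> k)"] by auto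
  have "growing_word S a (u @ v)"
    using growing_word_remove_leaf grow.prems(1) uv v orth by blast
  then have "reflection_product w = reflection_product (u @ v)"
    using grow.IH set_uv by blast
  then show ?case
    using reflection_product_move_to_front[OF orth] uv by simp
qed

section \<open>Connectedness of the base of an irreducible root system\<close>

locale based_root_system =
  fixes \<Phi> S :: "'a::euclidean_space set"
  assumes root_system: "root_system \<Phi>"
    and root_base: "root_base \<Phi> S"
begin

lemma S_subset: "S \<subseteq> \<Phi>" and independent_S: "independent S"
  using root_base by (auto simp: root_base_def)

lemma finite_S: "finite S"
  using independent_S independent_imp_finite by blast

lemma zero_notin_roots: "0 \<notin> \<Phi>"
  using root_system by (auto simp: root_system_def)

lemma zero_notin_S: "0 \<notin> S"
  using zero_notin_roots S_subset by auto

lemma reflection_root: "a \<in> \<Phi> \<Longrightarrow> b \<in> \<Phi> \<Longrightarrow> reflection a b \<in> \<Phi>"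
  and cartan_int: "a \<in> \<Phi> \<Longrightarrow> b \<in> \<Phi> \<Longrightarrow> cartan b a \<in> \<int>"
  using root_system by (auto simp: root_system_def)

lemma uminus_root: "a \<in> \<Phi> \<Longrightarrow> - a \<in> \<Phi>"
  using reflection_root[of a a] reflection_self[of a] zero_notin_roots by metis

lemma reflection_product_root: "set w \<subseteq> \<Phi> \<Longrightarrow> b \<in> \<Phi> \<Longrightarrow> reflection_product w b \<in> \<Phi>"
  by (induction w) (auto intro: reflection_root)

lemma scaleR_simple_in_span_rest:
  assumes "k \<in> S" "r *\<^sub>R k \<in> span (S - {k})"
  shows "r = 0"
proof (rule ccontr)
  assume "r \<noteq> 0"
  then have "k \<in> span (S - {k})"
    using span_scale[OF assms(2), of "1 / r"] by simp
  then show False using independent_S assms(1) by (auto simp: dependent_def)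
qed

lemma coefficient_unique:
  assumes "(\<Sum>x\<in>S. f x *\<^sub>R x) = (\<Sum>x\<in>S. g x *\<^sub>R x)" "x \<in> S"
  shows "f x = g x"
proof -
  have "(\<Sum>x\<in>S. (f x - g x) *\<^sub>R x) = 0"
    using assms(1) by (simp add: scaleR_diff_left sum_subtractf)
  then have "f x - g x = 0"
    using independentD[OF independent_S finite_S subset_refl, of "\<lambda>x. f x - g x"] assms(2) by blast
  then show ?thesis by simp
qed

lemma root_coefficients:
  assumes "b \<in> \<Phi>"
  obtains k :: "'a \<Rightarrow> int" where "b = (\<Sum>x\<in>S. of_int (k x) *\<^sub>R x)"
    "(\<forall>x\<in>S. 0 \<le> k x) \<or> (\<forall>x\<in>S. k x \<le> 0)"
  using assms root_base unfolding root_base_def by blast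

text \<open>
  Otherwise the reflection of \<open>a\<close> in \<open>b\<close> would be a root with coefficient \<open>1\<close> at \<open>a\<close> and a negative
  coefficient at \<open>b\<close>.
\<close>

lemma simple_roots_obtuse:
  assumes "a \<in> S" "b \<in> S" "a \<noteq> b"
  shows "a \<bullet> b \<le> 0"
proof (rule ccontr)
  assume "\<not> a \<bullet> b \<le> 0"
  moreover have "0 < b \<bullet> b" using zero_notin_S assms by (auto simp: inner_gt_zero_iff)
  ultimately have pos: "cartan a b > 0" by simp
  have "reflection b a \<in> \<Phi>" using assms S_subset reflection_root by blast
  then obtain k :: "'a \<Rightarrow> int" where k: "reflection b a = (\<Sum>x\<in>S. of_int (k x) *\<^sub>R x)"
    "(\<forall>x\<in>S. 0 \<le> k x) \<or> (\<forall>x\<in>S. k x \<le> 0)" by (rule root_coefficients)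
  let ?f = "\<lambda>x. if x = a then 1 else if x = b then - cartan a b else 0"
  have "(\<Sum>x\<in>S. ?f x *\<^sub>R x) = (\<Sum>x\<in>{a, b}. ?f x *\<^sub>R x)"
    using assms finite_S by (intro sum.mono_neutral_right) auto
  also have "\<dots> = reflection b a" using assms(3) by (simp add: reflection_def)
  finally have "\<And>x. x \<in> S \<Longrightarrow> ?f x = of_int (k x)"
    unfolding k(1) by (rule coefficient_unique)
  from this[of a] this[of b] have "k a = 1" "of_int (k b) = - cartan a b"
    using assms by auto
  moreover have "of_int (k b) < (0::real)" using calculation(2) pos by linarith
  ultimately show False using k(2) assms by force
qed

text \<open>
  By induction on the height of \<open>b\<close>.  Since \<open>b \<bullet> b > 0\<close>, some simple root \<open>a\<close> in the support of
  \<open>b\<close> has \<open>b \<bullet> a > 0\<close>.  Unless \<open>b\<close> is a multiple of \<open>a\<close>, the reflection \<open>r\<close> of \<open>b\<close> in \<open>a\<close>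
  still has a positive coefficient outside \<open>a\<close>, so it is a positive root of smaller height and lies
  in one of the two spans.  It is not orthogonal to \<open>a\<close>, so this is the span of the part containing
  \<open>a\<close>, and adding back a multiple of \<open>a\<close> stays inside.
\<close>

lemma positive_root_in_orthogonal_part:
  assumes AB: "A \<union> B = S" "A \<inter> B = {}" and orth: "\<forall>x\<in>A. \<forall>y\<in>B. x \<bullet> y = 0"
    and "b \<in> \<Phi>" "b = (\<Sum>x\<in>S. of_nat (k x) *\<^sub>R x)"
  shows "b \<in> span A \<or> b \<in> span B"
  using assms(4,5)
proof (induction "\<Sum>x\<in>S. k x" arbitrary: b k rule: less_induct)
  case less
  have "0 < b \<bullet> b" using less.prems zero_notin_roots by (auto simp: inner_gt_zero_iff)
  also have "b \<bullet> b = (\<Sum>x\<in>S. of_nat (k x) * (b \<bullet> x))"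
    by (subst (2) less.prems(2)) (simp add: inner_sum_right)
  finally have "\<not> (\<Sum>x\<in>S. of_nat (k x) * (b \<bullet> x)) \<le> 0" by simp
  then obtain a where a: "a \<in> S" "of_nat (k a) * (b \<bullet> a) > 0"
    using sum_nonpos[of S "\<lambda>x. of_nat (k x) * (b \<bullet> x)"] by (meson not_le)
  then have ka: "k a > 0" and ba: "b \<bullet> a > 0"
    by (auto simp: zero_less_mult_iff)
  have a0: "a \<noteq> 0" using a zero_notin_S by auto
  define r where "r = reflection a b"
  have r: "r \<in> \<Phi>" "r = b - cartan b a *\<^sub>R a"
    using reflection_root a S_subset less.prems by (auto simp: r_def reflection_def)
  have b_eq: "b = r + cartan b a *\<^sub>R a" using r by simp
  show ?case
  proof (cases "\<exists>x\<in>S - {a}. k x > 0")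
    case False
    then have "b = (\<Sum>x\<in>{a}. of_nat (k x) *\<^sub>R x)"
      unfolding less.prems(2) using finite_S a by (intro sum.mono_neutral_right) auto
    then have "b = of_nat (k a) *\<^sub>R a" by simp
    moreover have "a \<in> A \<or> a \<in> B" using a AB by auto
    ultimately show ?thesis by (auto intro: span_scale span_base)
  next
    case True
    then obtain z where z: "z \<in> S" "z \<noteq> a" "k z > 0" by auto
    from r(1) obtain l :: "'a \<Rightarrow> int" where l: "r = (\<Sum>x\<in>S. of_int (l x) *\<^sub>R x)"
      "(\<forall>x\<in>S. 0 \<le> l x) \<or> (\<forall>x\<in>S. l x \<le> 0)" by (rule root_coefficients)
    let ?f = "\<lambda>x. of_nat (k x) - (if x = a then cartan b a else 0)"
    have "(\<Sum>x\<in>S. ?f x *\<^sub>R x) = b - (\<Sum>x\<in>S. (if x = a then cartan b a else 0) *\<^sub>R x)"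
      by (subst (2) less.prems(2)) (simp add: scaleR_diff_left sum_subtractf)
    also have "(\<Sum>x\<in>S. (if x = a then cartan b a else 0) *\<^sub>R x)
        = (\<Sum>x\<in>{a}. (if x = a then cartan b a else 0) *\<^sub>R x)"
      using a finite_S by (intro sum.mono_neutral_right) auto
    finally have "(\<Sum>x\<in>S. ?f x *\<^sub>R x) = r" using r by simp
    then have fl: "?f x = of_int (l x)" if "x \<in> S" for x
      using coefficient_unique[of ?f "\<lambda>x. of_int (l x)"] l(1) that by simp
    have "l z > 0" using fl[OF z(1)] z by simp
    then have l0: "\<forall>x\<in>S. 0 \<le> l x" using l(2) z by force
    have la: "l x \<le> int (k x)" "x = a \<Longrightarrow> l x < int (k x)" if "x \<in> S" for x
    proof -
      have "cartan b a > 0" using ba a0 by simp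
      then have "real_of_int (l x) \<le> real (k x) \<and> (x = a \<longrightarrow> real_of_int (l x) < real (k x))"
        using fl[OF that] by (auto split: if_splits)
      then show "l x \<le> int (k x)" "x = a \<Longrightarrow> l x < int (k x)" by linarith+
    qed
    have "(\<Sum>x\<in>S. nat (l x)) < (\<Sum>x\<in>S. k x)"
    proof (rule sum_strict_mono_ex1[OF finite_S])
      show "\<forall>x\<in>S. nat (l x) \<le> k x" using la(1) by (auto simp: nat_le_iff)
      show "\<exists>x\<in>S. nat (l x) < k x" using la(2)[OF a(1)] ka a(1) by (intro bexI[of _ a]) auto
    qed
    moreover have "r = (\<Sum>x\<in>S. of_nat (nat (l x)) *\<^sub>R x)"
      unfolding l(1) using l0 by (intro sum.cong) auto
    ultimately have rAB: "r \<in> span A \<or> r \<in> span B"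
      using less.hyps[of "\<lambda>x. nat (l x)" r] r(1) by blast
    have same: "b \<in> span C" if "r \<in> span C" "a \<in> C" for C
      using that by (subst b_eq) (auto intro: span_add span_scale span_base)
    have perp: "False" if "r \<in> span C" "\<forall>x\<in>C. x \<bullet> a = 0" for C
    proof -
      have "r \<bullet> a = 0"
        using that orthogonal_to_span[of r C a] by (auto simp: orthogonal_def inner_commute)
      moreover have "r \<bullet> a = - (b \<bullet> a)"
        using a0 by (simp add: r inner_diff_left)
      ultimately show False using ba by simp
    qed
    show ?thesis
    proof (cases "a \<in> A")
      case True
      then have "r \<notin> span B" using perp[of B] orth by (auto simp: inner_commute)
      then show ?thesis using same True rAB by blast
    next
      case False
      then have "a \<in> B" using a AB by auto
      then have "r \<notin> span A" using perp[of A] orth by auto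
      then show ?thesis using same \<open>a \<in> B\<close> rAB by blast
    qed
  qed
qed

lemma root_in_orthogonal_part:
  assumes AB: "A \<union> B = S" "A \<inter> B = {}" and orth: "\<forall>x\<in>A. \<forall>y\<in>B. x \<bullet> y = 0"
    and b: "b \<in> \<Phi>"
  shows "b \<in> span A \<or> b \<in> span B"
proof -
  obtain k :: "'a \<Rightarrow> int" where k: "b = (\<Sum>x\<in>S. of_int (k x) *\<^sub>R x)"
    "(\<forall>x\<in>S. 0 \<le> k x) \<or> (\<forall>x\<in>S. k x \<le> 0)" using b by (rule root_coefficients)
  from k(2) show ?thesis
  proof
    assume "\<forall>x\<in>S. 0 \<le> k x"
    then have "b = (\<Sum>x\<in>S. of_nat (nat (k x)) *\<^sub>R x)"
      unfolding k(1) by (intro sum.cong) auto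
    then show ?thesis by (rule positive_root_in_orthogonal_part[OF AB orth b])
  next
    assume "\<forall>x\<in>S. k x \<le> 0"
    then have "- b = (\<Sum>x\<in>S. of_nat (nat (- k x)) *\<^sub>R x)"
      unfolding k(1) sum_negf[symmetric] by (intro sum.cong) auto
    then have "- b \<in> span A \<or> - b \<in> span B"
      by (rule positive_root_in_orthogonal_part[OF AB orth uminus_root[OF b]])
    then show ?thesis using span_neg by fastforce
  qed
qed

text \<open>
  An orthogonal splitting of the base would split the whole root system into the roots in
  \<open>span A\<close> and those in \<open>span B\<close>.
\<close>

lemma base_connected:
  assumes irr: "irreducible_root_system \<Phi>"
    and AB: "A \<union> B = S" "A \<inter> B = {}" "A \<noteq> {}" "B \<noteq> {}"
  shows "\<exists>x\<in>A. \<exists>y\<in>B. x \<bullet> y \<noteq> 0"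
proof (rule ccontr)
  assume "\<not> ?thesis"
  then have orth: "\<forall>x\<in>A. \<forall>y\<in>B. x \<bullet> y = 0" by auto
  have orth': "x \<bullet> y = 0" if "x \<in> span A" "y \<in> span B" for x y
  proof -
    have "z \<bullet> y = 0" if "z \<in> A" for z
      using orthogonal_to_span[OF \<open>y \<in> span B\<close>, of z] orth that by (auto simp: orthogonal_def)
    then show ?thesis
      using orthogonal_to_span[OF \<open>x \<in> span A\<close>, of y] by (auto simp: orthogonal_def inner_commute)
  qed
  let ?A = "\<Phi> \<inter> span A" and ?B = "\<Phi> \<inter> span B"
  have "?A \<union> ?B = \<Phi>" using root_in_orthogonal_part[OF AB(1,2) orth] by auto
  moreover have "?A \<inter> ?B = {}" using orth' zero_notin_roots by (metis IntE disjoint_iff inner_eq_zero_iff)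
  moreover have "A \<subseteq> ?A" "B \<subseteq> ?B" using AB S_subset span_superset by blast+
  then have "?A \<noteq> {}" "?B \<noteq> {}" using AB by auto
  moreover have "\<forall>a\<in>?A. \<forall>b\<in>?B. a \<bullet> b = 0" using orth' by auto
  ultimately have "\<exists>A B. A \<noteq> {} \<and> B \<noteq> {} \<and> A \<union> B = \<Phi> \<and> A \<inter> B = {} \<and>
      (\<forall>a\<in>A. \<forall>b\<in>B. a \<bullet> b = 0)"
    by (intro exI[of _ ?A] exI[of _ ?B] conjI)
  then show False using irr unfolding irreducible_root_system_def by (elim conjE notE)
qed

section \<open>Products sending a simple root to minus the sum of the base\<close>

lemma sum_list_span_rest:
  "set w \<subseteq> S \<Longrightarrow> k \<notin> set w \<Longrightarrow> sum_list w \<in> span (S - {k})"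
  by (induction w) (auto intro: span_add span_base span_zero)

lemma product_span_rest:
  assumes "set w \<subseteq> S" "k \<notin> set w" "a \<in> S" "k \<noteq> a"
  shows "reflection_product w a \<in> span (S - {k})"
  using assms by (intro reflection_product_in_span span_base) auto

text \<open>
  This excludes letters acting before \<open>a\<close> itself.  The first of them, say \<open>k\<close>, would have to turn
  \<open>a\<close> into \<open>a - k\<close>, that is, have Cartan number \<open>1\<close> with \<open>a\<close>, although distinct simple roots form
  an obtuse angle.  The induction peels off the letter acting last, whose coefficient before it
  acts is still \<open>0\<close>.
\<close>

lemma product_subtracting_letters_Nil:
  assumes "a \<in> S" "a \<notin> set w" "distinct w" "set w \<subseteq> S"
    and "reflection_product w a = a - sum_list w"
  shows "w = []"
  using assms
proof (induction w)
  case (Cons k w)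
  have k0: "k \<noteq> 0" using Cons.prems zero_notin_S by auto
  have "reflection k (reflection_product w a) = a - sum_list w - k"
    using Cons.prems(5) by simp
  then have "reflection_product w a = reflection k (a - sum_list w - k)"
    using reflection_involution[OF k0, of "reflection_product w a"] by simp
  also have "\<dots> = (1 - cartan (a - sum_list w) k) *\<^sub>R k + (a - sum_list w)"
    unfolding linear_diff[OF linear_reflection] reflection_self[OF k0]
    by (simp add: reflection_def inner_diff_left algebra_simps diff_divide_distrib)
  finally have eq: "reflection_product w a = \<dots>" .
  have "(1 - cartan (a - sum_list w) k) *\<^sub>R k = reflection_product w a - (a - sum_list w)"
    using eq by simp
  moreover have "\<dots> \<in> span (S - {k})"
    using Cons.prems by (intro span_diff product_span_rest sum_list_span_rest span_base) auto
  ultimately have c: "1 - cartan (a - sum_list w) k = 0"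
    using scaleR_simple_in_span_rest Cons.prems by (metis insert_subset list.simps(15))
  then have "reflection_product w a = a - sum_list w" using eq by (simp only: scaleR_zero_left add_0)
  then have "w = []" using Cons by auto
  then have "cartan a k = 1" using c by (simp only: sum_list.Nil diff_zero)
  moreover have "a \<bullet> k \<le> 0" using simple_roots_obtuse Cons.prems by auto
  ultimately show ?case by (smt (verit) divide_nonpos_nonneg inner_ge_zero)
qed simp

text \<open>
  Again the letter \<open>k\<close> acting last is peeled off.  Before it acts, the coefficient of \<open>k\<close> is
  \<open>1 + cartan (sum_list w) k\<close>.  If \<open>k\<close> is not \<open>a\<close>, this coefficient is still \<open>0\<close>, which is the
  growth condition.  If \<open>k\<close> is \<open>a\<close>, it is still \<open>1\<close>, and the previous lemma shows that there
  are no letters acting before it.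
\<close>

lemma growing_word_if_product:
  assumes "a \<in> S" "w \<noteq> []" "distinct w" "set w \<subseteq> S"
    and "reflection_product w a = - sum_list w"
  shows "growing_word S a w"
  using assms
proof (induction w)
  case (Cons k w)
  have k0: "k \<noteq> 0" using Cons.prems zero_notin_S by auto
  have "reflection k (reflection_product w a) = - sum_list w - k"
    using Cons.prems(5) by simp
  then have "reflection_product w a = reflection k (- sum_list w - k)"
    using reflection_involution[OF k0, of "reflection_product w a"] by simp
  also have "\<dots> = (1 + cartan (sum_list w) k) *\<^sub>R k - sum_list w"
    unfolding linear_diff[OF linear_reflection] reflection_self[OF k0]
    by (simp add: reflection_def inner_diff_left algebra_simps diff_divide_distrib)
  finally have eq: "reflection_product w a = \<dots>" .
  have sum_span: "sum_list w \<in> span (S - {k})"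
    using Cons.prems by (intro sum_list_span_rest) auto
  show ?case
  proof (cases "k = a")
    case True
    have "reflection_product w a - a \<in> span (set w)" for w :: "'a list"
    proof (induction w)
      case (Cons x w)
      have "reflection_product w a - a \<in> span (set (x # w))"
        using Cons span_mono[of "set w" "set (x # w)"] by auto
      then have "(reflection_product w a - a) - cartan (reflection_product w a) x *\<^sub>R x
          \<in> span (set (x # w))"
        by (rule span_diff) (simp add: span_scale span_base)
      then show ?case by (simp add: reflection_def algebra_simps)
    qed (simp add: span_zero)
    moreover have "span (set w) \<subseteq> span (S - {k})"
      using Cons.prems by (intro span_mono) auto
    ultimately have "reflection_product w a - a + sum_list w \<in> span (S - {k})"
      using sum_span by (intro span_add) auto
    moreover have "reflection_product w a - a + sum_list w = cartan (sum_list w) k *\<^sub>R k"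
      using eq True by (simp add: scaleR_add_left)
    ultimately have "cartan (sum_list w) k = 0"
      using scaleR_simple_in_span_rest Cons.prems(1) True by metis
    then have "reflection_product w a = a - sum_list w"
      using eq True by (simp only: add_0_right scaleR_one)
    then have "w = []" using product_subtracting_letters_Nil Cons.prems True by auto
    then show ?thesis using True Cons.prems growing_word.start by auto
  next
    case False
    have "(1 + cartan (sum_list w) k) *\<^sub>R k = reflection_product w a + sum_list w"
      using eq by simp
    moreover have "\<dots> \<in> span (S - {k})"
      using Cons.prems False sum_span by (intro span_add product_span_rest) auto
    ultimately have c: "1 + cartan (sum_list w) k = 0"
      using scaleR_simple_in_span_rest Cons.prems by (metis insert_subset list.simps(15))
    then have "w \<noteq> []" by auto
    moreover have "reflection_product w a = - sum_list w" using eq c by simp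
    ultimately have "growing_word S a w" using Cons by auto
    moreover have "cartan (sum_list w) k = -1" using c by linarith
    ultimately show ?thesis using Cons.prems by (intro growing_word.grow) auto
  qed
qed simp

lemma product_iff_growing_word:
  assumes "a \<in> S" "distinct w" "set w = S"
  shows "reflection_product w a = - \<Sum>S \<longleftrightarrow> growing_word S a w"
proof -
  have "sum_list w = \<Sum>S" using assms distinct_sum_list_conv_Sum by metis
  then show ?thesis
    using growing_word_if_product[of a w] reflection_product_growing_word[of S a w]
      zero_notin_S assms by (metis empty_iff empty_set order_refl)
qed

section \<open>Lengths and the existence of growing words\<close>

lemma sum_list_growing_word:
  assumes "growing_word S a w"
  shows "sum_list w \<in> \<Phi>" "norm (sum_list w) = norm a"
proof -
  have eq: "sum_list w = - reflection_product w a"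
    using reflection_product_growing_word[OF assms zero_notin_S] by simp
  have "reflection_product w a \<in> \<Phi>"
    using growing_word_facts[OF assms] S_subset by (intro reflection_product_root) auto
  then show "sum_list w \<in> \<Phi>" using eq uminus_root by simp
  show "norm (sum_list w) = norm a" using eq norm_reflection_product[of w a] by simp
qed

text \<open>
  If the sum \<open>v\<close> has Cartan number \<open>-1\<close> against \<open>k'\<close>, then the opposite Cartan number, a nonzero
  integer, has absolute value \<open>(k' \<bullet> k') / (v \<bullet> v)\<close>, so \<open>k'\<close> is at least as long as \<open>v\<close> and hence
  as \<open>a\<close>.
\<close>

lemma growing_word_norm_le:
  assumes "growing_word S a w" "k \<in> set w"
  shows "norm a \<le> norm k"
  using assms
proof induction
  case (grow w k')
  show ?case
  proof (cases "k = k'")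
    case True
    let ?v = "sum_list w"
    have v: "?v \<in> \<Phi>" "norm ?v = norm a" using sum_list_growing_word[OF grow.hyps(1)] by auto
    have k': "k' \<in> \<Phi>" "k' \<noteq> 0" using grow.hyps S_subset zero_notin_S by auto
    have vk: "2 * (?v \<bullet> k') = - (k' \<bullet> k')"
      using grow.hyps k' by (simp add: field_simps)
    have "cartan k' ?v \<in> \<int>" using cartan_int v k' by blast
    moreover have v0: "?v \<bullet> ?v > 0" using v zero_notin_roots by (auto simp: inner_gt_zero_iff)
    moreover have "cartan k' ?v \<noteq> 0" using vk v0 k' by (simp add: inner_commute)
    ultimately have "1 \<le> \<bar>cartan k' ?v\<bar>" using Ints_nonzero_abs_ge1 by blast
    also have "\<bar>cartan k' ?v\<bar> = (k' \<bullet> k') / (?v \<bullet> ?v)"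
      using vk v0 by (simp add: inner_commute abs_divide)
    finally have "?v \<bullet> ?v \<le> k' \<bullet> k'" using v0 by (simp add: field_simps)
    then show ?thesis using True v by (simp add: norm_le[symmetric])
  qed (use grow in auto)
qed simp

text \<open>
  A growing word that misses a simple root can be extended.  By connectedness some missing \<open>k\<close> is
  not orthogonal to some letter of the word, so its Cartan number with the sum \<open>v\<close> is negative.
  Since \<open>v\<close> is as long as \<open>a\<close>, thus no longer than \<open>k\<close>, and not proportional to \<open>k\<close>, the strict
  Cauchy--Schwarz inequality places this integer above \<open>-2\<close>.
\<close>

lemma growing_word_exists:
  assumes irr: "irreducible_root_system \<Phi>"
    and a: "a \<in> S" "\<forall>k\<in>S. norm a \<le> norm k"
  shows "\<exists>w. growing_word S a w \<and> set w = S"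
proof -
  have step: "\<exists>k. growing_word S a (k # w)" if w: "growing_word S a w" "set w \<noteq> S" for w
  proof -
    note facts = growing_word_facts[OF w(1)]
    have "\<exists>x\<in>set w. \<exists>y\<in>S - set w. x \<bullet> y \<noteq> 0"
      using facts w(2) by (intro base_connected[OF irr]) auto
    then obtain j k where jk: "j \<in> set w" "k \<in> S" "k \<notin> set w" "j \<bullet> k \<noteq> 0" by auto
    let ?v = "sum_list w"
    have v: "?v \<in> \<Phi>" "norm ?v = norm a" using sum_list_growing_word[OF w(1)] by auto
    have k0: "k \<noteq> 0" using jk zero_notin_S by auto
    have nonpos: "x \<bullet> k \<le> 0" if "x \<in> set w" for x
      using simple_roots_obtuse facts jk that by auto
    have "?v \<bullet> k = (\<Sum>x\<in>set w. x \<bullet> k)"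
      using facts distinct_sum_list_conv_Sum[of w] by (simp add: inner_sum_left)
    also have "\<dots> < (\<Sum>x\<in>set w. 0)"
      using nonpos jk by (intro sum_strict_mono_ex1) (auto simp: less_le)
    finally have neg: "?v \<bullet> k < 0" by simp
    have "\<bar>?v \<bullet> k\<bar> \<noteq> norm ?v * norm k"
    proof
      assume "\<bar>?v \<bullet> k\<bar> = norm ?v * norm k"
      then have "norm ?v *\<^sub>R k = norm k *\<^sub>R ?v \<or> norm ?v *\<^sub>R k = - norm k *\<^sub>R ?v"
        using norm_cauchy_schwarz_abs_eq[of ?v k] by blast
      moreover have "?v \<in> span (S - {k})" using sum_list_span_rest facts jk by blast
      ultimately have "norm ?v *\<^sub>R k \<in> span (S - {k})" by (metis span_scale)
      then have "norm ?v = 0" using scaleR_simple_in_span_rest jk(2) by blast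
      then show False using v zero_notin_roots by auto
    qed
    then have "\<bar>?v \<bullet> k\<bar> < norm ?v * norm k"
      using Cauchy_Schwarz_ineq2[of ?v k] by linarith
    also have "\<dots> \<le> norm k * norm k" using v a jk by (intro mult_right_mono) auto
    also have "\<dots> = k \<bullet> k" by (simp add: dot_square_norm power2_eq_square)
    finally have "- (k \<bullet> k) < ?v \<bullet> k" by linarith
    then have "-2 < cartan ?v k" "cartan ?v k < 0"
      using neg k0 by (auto simp: field_simps)
    moreover have "cartan ?v k \<in> \<int>" using cartan_int jk S_subset v by blast
    then obtain m :: int where "cartan ?v k = of_int m" by (elim Ints_cases)
    ultimately have "-2 < m" "m < 0" by simp_all
    then have "m = -1" by simp
    with \<open>cartan ?v k = of_int m\<close> have "cartan ?v k = -1" by simp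
    then show ?thesis using growing_word.grow w jk by blast
  qed
  have "\<exists>w. growing_word S a w \<and> (set w = S \<or> length w = Suc m)" for m
  proof (induction m)
    case 0
    then show ?case using growing_word.start[OF a(1)] by force
  next
    case (Suc m)
    then show ?case using step by (metis length_Cons)
  qed
  from this[of "card S"] obtain w where w: "growing_word S a w" "set w = S \<or> length w = Suc (card S)"
    by auto
  moreover have "length w \<le> card S"
    using growing_word_facts[OF w(1)] card_mono[OF finite_S] distinct_card[of w] by metis
  ultimately show ?thesis by auto
qed

text \<open>
  Two simple roots that are not orthogonal have nonzero integral Cartan numbers with product at
  most \<open>1\<close>, hence of equal absolute value, hence equal lengths.  Connectedness spreads this to the
  whole base.
\<close>

lemma simply_laced_norm_eq:
  assumes irr: "irreducible_root_system \<Phi>" and sl: "simply_laced S"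
    and "a \<in> S" "k \<in> S"
  shows "norm a = norm k"
proof (rule ccontr)
  assume ne: "norm a \<noteq> norm k"
  have "\<exists>x\<in>{x\<in>S. norm x = norm a}. \<exists>y\<in>{y\<in>S. norm y \<noteq> norm a}. x \<bullet> y \<noteq> 0"
    using assms(3,4) ne by (intro base_connected[OF irr]) auto
  then obtain x y where xy: "x \<in> S" "y \<in> S" "norm x \<noteq> norm y" "x \<bullet> y \<noteq> 0" by auto
  have ge1: "1 \<le> \<bar>cartan u v\<bar>" if "u \<in> S" "v \<in> S" "u \<bullet> v \<noteq> 0" for u v
  proof -
    have "cartan u v \<in> \<int>" using cartan_int that S_subset by blast
    moreover have "cartan u v \<noteq> 0" using that zero_notin_S by auto
    ultimately show ?thesis using Ints_nonzero_abs_ge1 by blast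
  qed
  have le: "cartan x y * cartan y x \<le> 1" using sl xy unfolding simply_laced_def by auto
  have "cartan x y * cartan y x \<ge> 0" by (simp add: inner_commute)
  then have "\<bar>cartan x y\<bar> * \<bar>cartan y x\<bar> \<le> 1" using le by (simp add: abs_mult[symmetric])
  moreover have g: "1 \<le> \<bar>cartan x y\<bar>" "1 \<le> \<bar>cartan y x\<bar>"
    using ge1[of x y] ge1[of y x] xy by (simp_all add: inner_commute[of y x])
  ultimately have "\<bar>cartan x y\<bar> = \<bar>cartan y x\<bar>"
    by (smt (verit) mult_le_cancel_left1 mult_le_cancel_right1)
  then have "x \<bullet> x = y \<bullet> y"
    using xy zero_notin_S by (simp add: abs_mult inner_commute field_simps)
  then show False using xy by (simp add: norm_eq)
qed

text \<open>
  With equal lengths the two Cartan numbers of a pair agree, and \<open>x \<noteq> - y\<close> leaves only the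
  values \<open>0\<close> and \<open>-1\<close>.
\<close>

lemma simply_laced_if_norm_eq:
  assumes eq: "\<And>x y. x \<in> S \<Longrightarrow> y \<in> S \<Longrightarrow> norm x = norm y"
  shows "simply_laced S"
  unfolding simply_laced_def
proof (intro ballI impI)
  fix x y assume xy: "x \<in> S" "y \<in> S" "x \<noteq> y"
  have yy: "x \<bullet> x = y \<bullet> y" using eq[OF xy(1,2)] by (simp add: norm_eq)
  have y0: "y \<bullet> y > 0" using xy zero_notin_S by (auto simp: inner_gt_zero_iff)
  have "0 < (x + y) \<bullet> (x + y)"
  proof -
    have "x \<noteq> - y"
    proof
      assume "x = - y"
      moreover have "- y \<in> span {y}" by (simp add: span_base span_neg)
      ultimately have "1 *\<^sub>R x \<in> span (S - {x})"
        using span_mono[of "{y}" "S - {x}"] xy by auto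
      then show False using scaleR_simple_in_span_rest xy(1) by fastforce
    qed
    then show ?thesis by (simp add: inner_gt_zero_iff add_eq_0_iff2)
  qed
  then have "- (y \<bullet> y) < x \<bullet> y"
    by (simp add: inner_add_left inner_add_right yy inner_commute)
  then have "-2 < cartan x y" using y0 by (simp add: field_simps)
  moreover have "cartan x y \<le> 0"
    using simple_roots_obtuse[OF xy] y0 by (simp add: divide_nonpos_pos)
  moreover have "cartan x y \<in> \<int>" using cartan_int xy S_subset by blast
  then obtain m where m: "cartan x y = of_int m" by (elim Ints_cases)
  ultimately have "m = 0 \<or> m = -1" by auto
  then have "cartan x y * cartan x y \<le> 1" using m by auto
  then show "cartan x y * cartan y x \<le> 1" using yy by (simp add: inner_commute)
qed

section \<open>Coxeter elements as products of words\<close>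

lemma coxeter_elements_eq_products:
  assumes \<alpha>: "bij_betw \<alpha> {1..n} S"
  shows "coxeter_elements \<Phi> n \<alpha> = {reflection_product w | w. distinct w \<and> set w = S}"
proof (intro equalityI subsetI)
  fix c assume "c \<in> coxeter_elements \<Phi> n \<alpha>"
  then obtain \<sigma> where \<sigma>: "\<sigma> permutes {1..n}"
    and c: "c = foldr (\<circ>) (map (\<lambda>k. reflection (\<alpha> (\<sigma> k))) [1..<Suc n]) id"
    unfolding coxeter_elements_def by blast
  define w where "w = map (\<alpha> \<circ> \<sigma>) [1..<Suc n]"
  have "bij_betw (\<alpha> \<circ> \<sigma>) {1..n} S"
    using bij_betw_trans[OF permutes_imp_bij[OF \<sigma>] \<alpha>] .
  moreover have "set [1..<Suc n] = {1..n}" by auto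
  ultimately have "distinct w" "set w = S"
    unfolding w_def by (auto simp only: distinct_map bij_betw_def set_map distinct_upt)
  moreover have "c = reflection_product w"
    unfolding c w_def reflection_product_def by (simp add: comp_def)
  ultimately show "c \<in> {reflection_product w | w. distinct w \<and> set w = S}" by blast
next
  fix c assume "c \<in> {reflection_product w | w. distinct w \<and> set w = S}"
  then obtain w where w: "distinct w" "set w = S" "c = reflection_product w" by blast
  have "card S = n" using bij_betw_same_card[OF \<alpha>] by simp
  then have len: "length w = n" using distinct_card w by metis
  \<comment> \<open>Positions in a list start at \<open>0\<close>, the enumeration of the simple roots at \<open>1\<close>.\<close>
  define \<tau> where "\<tau> = (\<lambda>k. inv_into {1..n} \<alpha> (w ! (k - 1)))"
  define \<sigma> where "\<sigma> = (\<lambda>k. if k \<in> {1..n} then \<tau> k else k)"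
  have "bij_betw (\<lambda>k. k - 1) {1..n} {..<n}"
    by (rule bij_betwI[where g = Suc]) auto
  moreover have "bij_betw (\<lambda>k. w ! k) {..<n} S"
    using bij_betw_nth[OF w(1), of "{..<n}" S] w len by auto
  ultimately have "bij_betw (\<lambda>k. w ! (k - 1)) {1..n} S"
    using bij_betw_trans[of "\<lambda>k. k - 1" "{1..n}" "{..<n}" "\<lambda>k. w ! k" S] by (simp add: comp_def)
  then have "bij_betw \<tau> {1..n} {1..n}"
    using bij_betw_trans[OF _ bij_betw_inv_into[OF \<alpha>]] by (fastforce simp: \<tau>_def comp_def)
  then have "bij_betw \<sigma> {1..n} {1..n}"
    by (rule bij_betw_cong[THEN iffD1, rotated]) (simp add: \<sigma>_def)
  then have \<sigma>: "\<sigma> permutes {1..n}"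
    by (rule bij_imp_permutes) (auto simp: \<sigma>_def)
  have "\<alpha> (\<sigma> k) = w ! (k - 1)" if "k \<in> {1..n}" for k
  proof -
    have "w ! (k - 1) \<in> \<alpha> ` {1..n}"
      using \<alpha> w len that by (auto simp: bij_betw_def)
    then show ?thesis using that by (simp add: \<sigma>_def \<tau>_def f_inv_into_f)
  qed
  then have "map (\<lambda>k. \<alpha> (\<sigma> k)) [1..<Suc n] = w"
    using len by (intro nth_equalityI) (auto simp del: upt_Suc)
  then have "map (\<lambda>k. reflection (\<alpha> (\<sigma> k))) [1..<Suc n] = map reflection w"
    by (auto simp del: upt_Suc)
  then have "c = foldr (\<circ>) (map (\<lambda>k. reflection (\<alpha> (\<sigma> k))) [1..<Suc n]) id"
    using w by (simp add: reflection_product_def)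
  moreover have "c \<in> weyl_group \<Phi>"
    using w S_subset reflection_product_in_weyl_group by blast
  ultimately show "c \<in> coxeter_elements \<Phi> n \<alpha>"
    using \<sigma> unfolding coxeter_elements_def by blast
qed

lemma coxeter_element_iff_growing_word:
  assumes "bij_betw \<alpha> {1..n} S" "a \<in> S"
  shows "c \<in> coxeter_elements \<Phi> n \<alpha> \<and> inv c (\<Sum>t=1..n. \<alpha> t) = - a \<longleftrightarrow>
    (\<exists>w. growing_word S a w \<and> set w = S \<and> c = reflection_product w)"
proof -
  have "(\<Sum>t=1..n. \<alpha> t) = \<Sum>S"
    using sum.reindex_bij_betw[OF assms(1), of "\<lambda>x. x"] by simp
  then have "inv (reflection_product w) (\<Sum>t=1..n. \<alpha> t) = - a \<longleftrightarrow> growing_word S a w"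
    if "distinct w" "set w = S" for w
    using reflection_product_eq_iff_preimage[of w "\<Sum>S" a]
      product_iff_growing_word[OF assms(2) that] zero_notin_S that by simp
  then show ?thesis
    unfolding coxeter_elements_eq_products[OF assms(1)] using growing_word_facts by blast
qed

lemma unique_coxeter_element:
  assumes irr: "irreducible_root_system \<Phi>" and \<alpha>: "bij_betw \<alpha> {1..n} S"
    and a: "a \<in> S" "\<forall>k\<in>S. norm a \<le> norm k"
  shows "\<exists>!c. c \<in> coxeter_elements \<Phi> n \<alpha> \<and> inv c (\<Sum>t=1..n. \<alpha> t) = - a"
  unfolding coxeter_element_iff_growing_word[OF \<alpha> a(1)]
  using growing_word_exists[OF irr a] growing_word_product_unique[OF simple_roots_obtuse] by metis

lemma norm_le_if_coxeter_element:
  assumes "bij_betw \<alpha> {1..n} S" "a \<in> S"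
    and "c \<in> coxeter_elements \<Phi> n \<alpha>" "inv c (\<Sum>t=1..n. \<alpha> t) = - a"
  shows "\<forall>k\<in>S. norm a \<le> norm k"
  using coxeter_element_iff_growing_word[OF assms(1,2), of c] assms(3,4) growing_word_norm_le by blast

end

theorem lemma1p4:
  fixes \<Phi> :: "'a::euclidean_space set" and n :: nat and \<alpha> :: "nat \<Rightarrow> 'a" and S :: "'a set"
  assumes "irreducible_root_system \<Phi>"
    and "DIM('a) = n" and "n \<ge> 2"
    and "root_base \<Phi> S" and "bij_betw \<alpha> {1..n} S"
  shows
    "(simply_laced S \<longrightarrow>
        (\<forall>i\<in>{1..n}. \<exists>!c. c \<in> coxeter_elements \<Phi> n \<alpha> \<and> inv c (\<Sum>t=1..n. \<alpha> t) = - \<alpha> i)) \<and>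
     (\<not> simply_laced S \<longrightarrow>
        (\<forall>i\<in>{1..n}. short_root \<Phi> (\<alpha> i) \<longrightarrow>
           (\<exists>!c. c \<in> coxeter_elements \<Phi> n \<alpha> \<and> inv c (\<Sum>t=1..n. \<alpha> t) = - \<alpha> i)) \<and>
        (\<forall>i\<in>{1..n}. long_root \<Phi> (\<alpha> i) \<longrightarrow>
           \<not> (\<exists>c \<in> coxeter_elements \<Phi> n \<alpha>. inv c (\<Sum>t=1..n. \<alpha> t) = - \<alpha> i)))"
proof -
  interpret based_root_system \<Phi> S
    using assms by unfold_locales (auto simp: irreducible_root_system_def)
  have mem: "\<alpha> i \<in> S" if "i \<in> {1..n}" for i
    using bij_betw_apply[OF assms(5) that] .
  note unique = unique_coxeter_element[OF assms(1,5) mem]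
  show ?thesis
  proof (intro conjI impI ballI notI)
    fix i assume "simply_laced S" "i \<in> {1..n}"
    then have "\<forall>k\<in>S. norm (\<alpha> i) \<le> norm k"
      by (intro ballI eq_refl simply_laced_norm_eq[OF assms(1)] mem)
    then show "\<exists>!c. c \<in> coxeter_elements \<Phi> n \<alpha> \<and> inv c (\<Sum>t=1..n. \<alpha> t) = - \<alpha> i"
      using unique \<open>i \<in> {1..n}\<close> by blast
  next
    fix i assume i: "i \<in> {1..n}" and "short_root \<Phi> (\<alpha> i)"
    then have "\<forall>k\<in>S. norm (\<alpha> i) \<le> norm k"
      using S_subset by (auto simp: short_root_def)
    then show "\<exists>!c. c \<in> coxeter_elements \<Phi> n \<alpha> \<and> inv c (\<Sum>t=1..n. \<alpha> t) = - \<alpha> i"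
      using unique i by blast
  next
    fix i assume i: "i \<in> {1..n}" and long: "long_root \<Phi> (\<alpha> i)" and "\<not> simply_laced S"
      and "\<exists>c \<in> coxeter_elements \<Phi> n \<alpha>. inv c (\<Sum>t=1..n. \<alpha> t) = - \<alpha> i"
    then have "\<forall>k\<in>S. norm (\<alpha> i) \<le> norm k"
      using norm_le_if_coxeter_element[OF assms(5) mem] by blast
    then have "norm k = norm (\<alpha> i)" if "k \<in> S" for k
      using long that S_subset by (force simp: long_root_def)
    then have "simply_laced S" by (intro simply_laced_if_norm_eq) simp
    then show False using \<open>\<not> simply_laced S\<close> by blast
  qed
qed

end
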